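(* Let $G_n$ ($n\ge1$) be the approximating graphs of the Diamond fractal. Then the number of spanning trees of $G_n$ is $$\tau(G_n)=2^{\frac23(4^n-1)},\qquad n\ge1.$$
   Context: Diamond fractal graphs: $G_1$ is the 4-cycle $a-u-b-v-a$ (with $a,b$ the two boundary vertices). For $n\ge2$, $G_n$ is obtained from $G_{n-1}$ by replacing every edge $\{x,y\}$ by a 4-cycle $x-u_{xy}-y-v_{xy}-x$ with two new vertices $u_{xy},v_{xy}$ (distinct for distinct edges). *)

theory Defs
  imports Complex_Main "HOL-Library.FSet"
begin

section \<open>Finite simple graphs and spanning trees\<close>

text \<open>
  The notions \<open>tree\<close> and \<open>spanning_tree\<close> of the AFP entry \<open>Graph_Theory\<close> exclude directed cycles
  only, and there an edge traversed back and forth is a cycle. They do not give the usual notion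
  for undirected graphs, so undirected graphs are introduced here, with edges as two-element sets.
\<close>

record 'a ugraph =
  verts :: "'a set"
  edges :: "'a set set"

definition simple_graph :: "'a ugraph \<Rightarrow> bool" where
  "simple_graph G \<longleftrightarrow> finite (verts G) \<and>
     (\<forall>e\<in>edges G. \<exists>x\<in>verts G. \<exists>y\<in>verts G. x \<noteq> y \<and> e = {x, y})"

definition walk :: "'a ugraph \<Rightarrow> 'a list \<Rightarrow> bool" where
  "walk G xs \<longleftrightarrow> xs \<noteq> [] \<and> set xs \<subseteq> verts G \<and> successively (\<lambda>x y. {x, y} \<in> edges G) xs"

definition connected_graph :: "'a ugraph \<Rightarrow> bool" where
  "connected_graph G \<longleftrightarrow> verts G \<noteq> {} \<and>
     (\<forall>x\<in>verts G. \<forall>y\<in>verts G. \<exists>xs. walk G xs \<and> hd xs = x \<and> last xs = y)"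

text \<open>A cycle is listed without repeating its starting point; the closing edge is required
  separately.\<close>

definition graph_cycle :: "'a ugraph \<Rightarrow> 'a list \<Rightarrow> bool" where
  "graph_cycle G xs \<longleftrightarrow> walk G xs \<and> distinct xs \<and> length xs \<ge> 3 \<and> {last xs, hd xs} \<in> edges G"

definition tree :: "'a ugraph \<Rightarrow> bool" where
  "tree G \<longleftrightarrow> simple_graph G \<and> connected_graph G \<and> (\<nexists>xs. graph_cycle G xs)"

definition spanning_tree :: "'a ugraph \<Rightarrow> 'a ugraph \<Rightarrow> bool" where
  "spanning_tree T G \<longleftrightarrow> tree T \<and> verts T = verts G \<and> edges T \<subseteq> edges G"

definition num_spanning_trees :: "'a ugraph \<Rightarrow> nat" where
  "num_spanning_trees G = card {T. spanning_tree T G}"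

section \<open>The diamond fractal graphs\<close>

text \<open>
  The first four constructors are the vertices \<open>a, b, u, v\<close> of the initial 4-cycle. The vertices
  \<open>u\<^sub>x\<^sub>y\<close> and \<open>v\<^sub>x\<^sub>y\<close> are \<open>New_u {|x, y|}\<close> and \<open>New_v {|x, y|}\<close>: indexing by the unordered pair
  makes them independent of the orientation of the edge, and distinct for distinct edges.
  That they are not already present in the graph being refined is lemma \<open>diamond_fresh\<close> below.
\<close>

datatype dvertex = VA | VB | VU | VV | New_u "dvertex fset" | New_v "dvertex fset"

definition cycle4_edges :: "'a \<Rightarrow> 'a \<Rightarrow> 'a \<Rightarrow> 'a \<Rightarrow> 'a set set" where
  "cycle4_edges x u y v = {{x, u}, {u, y}, {y, v}, {v, x}}"

definition diamond_refine :: "dvertex ugraph \<Rightarrow> dvertex ugraph" where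
  "diamond_refine G =
     \<lparr> verts = verts G \<union> {New_u {|x, y|} | x y. {x, y} \<in> edges G}
                       \<union> {New_v {|x, y|} | x y. {x, y} \<in> edges G},
       edges = \<Union> {cycle4_edges x (New_u {|x, y|}) y (New_v {|x, y|}) | x y. {x, y} \<in> edges G} \<rparr>"

text \<open>The sequence starts at index 1; the value at 0 is unspecified.\<close>

fun diamond_graph :: "nat \<Rightarrow> dvertex ugraph" where
  "diamond_graph (Suc 0) = \<lparr> verts = {VA, VU, VB, VV}, edges = cycle4_edges VA VU VB VV \<rparr>"
| "diamond_graph (Suc (Suc n)) = diamond_refine (diamond_graph (Suc n))"

section \<open>Well-formedness of the construction\<close>

primrec depth :: "dvertex \<Rightarrow> nat" where
  "depth VA = 0"
| "depth VB = 0"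
| "depth VU = 0"
| "depth VV = 0"
| "depth (New_u e) = Suc (Max (fset (depth |`| e)))"
| "depth (New_v e) = Suc (Max (fset (depth |`| e)))"

lemma diamond_refine_sel:
  "verts (diamond_refine G) = verts G \<union> {New_u {|x, y|} | x y. {x, y} \<in> edges G}
                                       \<union> {New_v {|x, y|} | x y. {x, y} \<in> edges G}"
  "edges (diamond_refine G) =
     \<Union> {cycle4_edges x (New_u {|x, y|}) y (New_v {|x, y|}) | x y. {x, y} \<in> edges G}"
  by (simp_all add: diamond_refine_def)

lemma diamond_edge_depth:
  "x \<in> verts (diamond_graph (Suc n)) \<Longrightarrow> depth x \<le> n"
  "{x, y} \<in> edges (diamond_graph (Suc n)) \<Longrightarrow>
     x \<in> verts (diamond_graph (Suc n)) \<and> y \<in> verts (diamond_graph (Suc n)) \<and> x \<noteq> y \<and>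
     max (depth x) (depth y) = n"
proof (induction n arbitrary: x y)
  case 0
  { case 1 then show ?case by auto }
  { case 2 then show ?case by (auto simp: cycle4_edges_def doubleton_eq_iff) }
next
  case (Suc n)
  let ?G = "diamond_graph (Suc n)"
  have e: "x \<in> verts ?G \<and> y \<in> verts ?G \<and> x \<noteq> y"
      "depth (New_u {|x, y|}) = Suc n" "depth (New_v {|x, y|}) = Suc n"
      "depth x \<le> n" "depth y \<le> n"
    if "{x, y} \<in> edges ?G" for x y
    using Suc.IH(2)[OF that] by auto
  { case 1
    then show ?case
      using Suc.IH(1)[of x] e by (auto simp: diamond_refine_sel simp del: depth.simps) }
  { case 2
    then obtain p q where pq: "{p, q} \<in> edges ?G"
      "{x, y} \<in> cycle4_edges p (New_u {|p, q|}) q (New_v {|p, q|})"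
      by (auto simp: diamond_refine_sel)
    have new: "New_u {|p, q|} \<in> verts (diamond_graph (Suc (Suc n)))"
      "New_v {|p, q|} \<in> verts (diamond_graph (Suc (Suc n)))"
      using pq(1) by (auto simp: diamond_refine_sel)
    have old: "p \<in> verts (diamond_graph (Suc (Suc n)))" "q \<in> verts (diamond_graph (Suc (Suc n)))"
      using e(1)[OF pq(1)] by (auto simp: diamond_refine_sel)
    show ?case
      using pq(2) new old e(2-5)[OF pq(1)]
      by (auto simp: cycle4_edges_def doubleton_eq_iff
          simp del: depth.simps diamond_graph.simps) }
qed

lemma diamond_fresh:
  assumes "n \<ge> 1" "{x, y} \<in> edges (diamond_graph n)"
  shows "New_u {|x, y|} \<notin> verts (diamond_graph n)" "New_v {|x, y|} \<notin> verts (diamond_graph n)"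
proof -
  obtain m where m: "n = Suc m" using assms(1) by (cases n) auto
  have "depth (New_u {|x, y|}) = Suc m" "depth (New_v {|x, y|}) = Suc m"
    using diamond_edge_depth(2)[of x y m] assms(2) by (auto simp: m)
  then show "New_u {|x, y|} \<notin> verts (diamond_graph n)" "New_v {|x, y|} \<notin> verts (diamond_graph n)"
    using diamond_edge_depth(1)[of _ m] m by (metis not_less_eq_eq order_refl)+
qed

lemma simple_diamond_graph:
  assumes "n \<ge> 1"
  shows "simple_graph (diamond_graph n)"
proof -
  have fin: "finite (verts (diamond_graph (Suc m)))" for m
  proof (induction m)
    case (Suc m)
    let ?V = "verts (diamond_graph (Suc m))"
    have "verts (diamond_graph (Suc (Suc m))) \<subseteq> ?V
        \<union> (\<lambda>(x, y). New_u {|x, y|}) ` (?V \<times> ?V) \<union> (\<lambda>(x, y). New_v {|x, y|}) ` (?V \<times> ?V)"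
      using diamond_edge_depth(2)[of _ _ m] by (fastforce simp: diamond_refine_sel)
    with Suc show ?case by (meson finite_SigmaI finite_UnI finite_imageI finite_subset)
  qed simp
  have pair: "\<exists>x y. e = {x, y}" if "e \<in> edges (diamond_graph (Suc m))" for e m
    using that by (cases m) (auto simp: cycle4_edges_def diamond_refine_sel)
  obtain m where m: "n = Suc m" using assms by (cases n) auto
  show ?thesis
    unfolding simple_graph_def m using fin[of m] pair[of _ m] diamond_edge_depth(2)[of _ _ m] by metis
qed

end

theory Submission
  imports Defs "HOL-Library.FuncSet"
begin

text \<open>
  A graph is a tree iff it is connected and deleting any edge disconnects it. Let an edge set of
  the refined graph attach each new vertex of the gadget on \<open>e\<close> to a subset of the two ends
  of \<open>e\<close>. It is minimally connected iff every such subset is nonempty, in no gadget are both new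
  vertices attached to both ends, and the edges \<open>e\<close> whose gadget joins the ends of \<open>e\<close> form a
  spanning tree of the original graph. Every gadget, joined or not, then has 4 possible states, so
  one refinement multiplies the number of spanning trees by \<open>4 ^ |E|\<close>, and \<open>|E|\<close> by 4.
  The graph \<open>G\<^sub>1\<close> is itself the refinement of a single edge.
\<close>

section \<open>Trees as minimally connected graphs\<close>

definition linked :: "'a set set \<Rightarrow> 'a \<Rightarrow> 'a \<Rightarrow> bool" where
  "linked F = (\<lambda>x y. {x, y} \<in> F)\<^sup>*\<^sup>*"

definition connects :: "'a set \<Rightarrow> 'a set set \<Rightarrow> bool" where
  "connects V F \<longleftrightarrow> V \<noteq> {} \<and> (\<forall>x\<in>V. \<forall>y\<in>V. linked F x y)"

definition min_connects :: "'a set \<Rightarrow> 'a set set \<Rightarrow> bool" where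
  "min_connects V F \<longleftrightarrow> connects V F \<and> (\<forall>e\<in>F. \<not> connects V (F - {e}))"

lemma linked_refl [simp]: "linked F x x"
  by (simp add: linked_def)

lemma linked_edge: "{x, y} \<in> F \<Longrightarrow> linked F x y"
  by (auto simp: linked_def)

lemma linked_trans: "linked F x y \<Longrightarrow> linked F y z \<Longrightarrow> linked F x z"
  unfolding linked_def by (rule rtranclp_trans)

lemma linked_sym: "linked F x y \<Longrightarrow> linked F y x"
  unfolding linked_def
  by (rule sympD[OF symp_rtranclp]) (auto simp: symp_def insert_commute)

text \<open>Serves both to reroute paths into another edge set, with \<open>p\<close> the identity,
  and to project paths of the refined graph onto the original one, with \<open>p\<close> a
  retraction.\<close>

lemma linked_lift:
  assumes "linked F x y" and "\<And>x y. {x, y} \<in> F \<Longrightarrow> linked F' (p x) (p y)"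
  shows "linked F' (p x) (p y)"
  using assms(1) unfolding linked_def
proof (induction rule: rtranclp_induct)
  case (step y z)
  then show ?case using assms(2)[of y z] by (metis linked_def linked_trans)
qed simp

section \<open>Simple paths, cycles and redundant edges\<close>

lemma successively_rtranclp:
  "successively P xs \<Longrightarrow> xs \<noteq> [] \<Longrightarrow> P\<^sup>*\<^sup>* (hd xs) (last xs)"
proof (induction xs)
  case (Cons x xs)
  then show ?case
    by (cases xs) (auto intro: converse_rtranclp_into_rtranclp)
qed simp

text \<open>The path is extended at its front; if the new start already lies on the path, the suffix
  beginning there is taken instead.\<close>

lemma rtranclp_distinct_successively:
  assumes "P\<^sup>*\<^sup>* x y"
  shows "\<exists>xs. xs \<noteq> [] \<and> distinct xs \<and> successively P xs \<and> hd xs = x \<and> last xs = y"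
  using assms
proof (induction rule: converse_rtranclp_induct)
  case base
  show ?case by (rule exI[of _ "[y]"]) simp
next
  case (step x z)
  then obtain xs where xs: "xs \<noteq> []" "distinct xs" "successively P xs" "hd xs = z" "last xs = y"
    by blast
  show ?case
  proof (cases "x \<in> set xs")
    case True
    then obtain ys zs where "xs = ys @ x # zs" by (meson split_list)
    then show ?thesis using xs
      by (intro exI[of _ "x # zs"]) (auto simp: successively_append_iff)
  next
    case False
    then show ?thesis using xs step.hyps(1)
      by (intro exI[of _ "x # xs"]) (auto simp: successively_Cons)
  qed
qed

lemma successively_edges_verts:
  assumes "simple_graph G" "successively (\<lambda>x y. {x, y} \<in> edges G) xs" "hd xs \<in> verts G"
  shows "set xs \<subseteq> verts G"
  using assms(2,3)
proof (induction xs)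
  case (Cons x xs)
  show ?case
  proof (cases xs)
    case (Cons y ys)
    with Cons.prems have "{x, y} \<in> edges G" by simp
    then have "y \<in> verts G"
      using assms(1) unfolding simple_graph_def by (metis insert_iff singletonD)
    then show ?thesis using Cons.IH Cons.prems Cons by auto
  qed (use Cons.prems in auto)
qed simp

lemma connected_graph_iff_connects:
  assumes "simple_graph G"
  shows "connected_graph G \<longleftrightarrow> connects (verts G) (edges G)"
proof -
  have "(\<exists>xs. walk G xs \<and> hd xs = x \<and> last xs = y) \<longleftrightarrow> linked (edges G) x y"
    if "x \<in> verts G" for x y
  proof
    assume "\<exists>xs. walk G xs \<and> hd xs = x \<and> last xs = y"
    then show "linked (edges G) x y"
      unfolding walk_def linked_def by (metis (no_types, lifting) successively_rtranclp)
  next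
    assume "linked (edges G) x y"
    then obtain xs where "xs \<noteq> []" "successively (\<lambda>x y. {x, y} \<in> edges G) xs" "hd xs = x" "last xs = y"
      unfolding linked_def by (blast dest: rtranclp_distinct_successively)
    with that show "\<exists>xs. walk G xs \<and> hd xs = x \<and> last xs = y"
      unfolding walk_def using successively_edges_verts[OF assms] by blast
  qed
  then show ?thesis unfolding connected_graph_def connects_def by auto
qed

text \<open>The rest of the cycle still joins the two ends of the closing edge, so every use of that
  edge can be rerouted.\<close>

lemma connects_remove_cycle_edge:
  assumes "graph_cycle G xs" "connects V (edges G)"
  shows "connects V (edges G - {{last xs, hd xs}})"
proof -
  let ?e = "{last xs, hd xs}"
  have d: "distinct xs" and l: "length xs \<ge> 3"
    and s: "successively (\<lambda>x y. {x, y} \<in> edges G) xs"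
    using assms(1) by (auto simp: graph_cycle_def walk_def)
  have ne: "xs \<noteq> []" using l by auto
  \<comment> \<open>Length at least 3 matters here: on two vertices the only consecutive pair would
    be the closing edge itself.\<close>
  have "{xs ! i, xs ! Suc i} \<noteq> ?e" if "Suc i < length xs" for i
    using d l ne that
    by (auto simp: last_conv_nth hd_conv_nth doubleton_eq_iff nth_eq_iff_index_eq)
  with s have "successively (\<lambda>x y. {x, y} \<in> edges G - {?e}) xs"
    by (auto simp: successively_conv_nth)
  then have "linked (edges G - {?e}) (hd xs) (last xs)"
    unfolding linked_def using ne by (rule successively_rtranclp)
  then have step: "linked (edges G - {?e}) x y" if "{x, y} \<in> edges G" for x y
    using that linked_sym by (cases "{x, y} = ?e") (auto simp: doubleton_eq_iff intro: linked_edge)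
  have "linked (edges G - {?e}) x y" if "linked (edges G) x y" for x y
    by (rule linked_lift[where p = "\<lambda>x. x", OF that step])
  then show ?thesis using assms(2) by (auto simp: connects_def)
qed

text \<open>A simple path that avoids \<open>e\<close> joins the ends of \<open>e\<close>, and
  \<open>e\<close> closes it to a cycle.\<close>

lemma cycle_of_redundant_edge:
  assumes "simple_graph G" "e \<in> edges G" "connects (verts G) (edges G - {e})"
  shows "\<exists>xs. graph_cycle G xs"
proof -
  obtain x y where e: "x \<in> verts G" "y \<in> verts G" "x \<noteq> y" "e = {x, y}"
    using assms(1,2) by (auto simp: simple_graph_def)
  then have "linked (edges G - {e}) x y" using assms(3) by (simp add: connects_def)
  then obtain xs where xs: "xs \<noteq> []" "distinct xs" "hd xs = x" "last xs = y"
      and s: "successively (\<lambda>x y. {x, y} \<in> edges G - {e}) xs"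
    unfolding linked_def by (blast dest: rtranclp_distinct_successively)
  from s have s': "successively (\<lambda>x y. {x, y} \<in> edges G) xs"
    by (rule successively_mono) auto
  \<comment> \<open>One vertex would force \<open>x = y\<close>, and two vertices would make
    \<open>e\<close> an edge of the path.\<close>
  have "length xs \<ge> 3"
  proof (rule ccontr)
    assume "\<not> length xs \<ge> 3"
    with xs(1) obtain z z' where "xs = [z] \<or> xs = [z, z']"
      by (cases xs; cases "tl xs"; cases "tl (tl xs)") auto
    then show False using xs s e by auto
  qed
  moreover have "set xs \<subseteq> verts G"
    using successively_edges_verts[OF assms(1) s'] xs e by simp
  ultimately have "graph_cycle G xs"
    using xs s' assms(2) e by (simp add: graph_cycle_def walk_def insert_commute)
  then show ?thesis ..
qed

lemma tree_iff_min_connects: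
  assumes "simple_graph G"
  shows "tree G \<longleftrightarrow> min_connects (verts G) (edges G)"
  unfolding tree_def min_connects_def connected_graph_iff_connects[OF assms]
  using assms cycle_of_redundant_edge connects_remove_cycle_edge
  by (metis graph_cycle_def)

text \<open>The vertex set is fixed, so a spanning tree is determined by its edge set; simplicity is
  inherited from \<open>G\<close>.\<close>

lemma num_spanning_trees_eq:
  assumes "simple_graph G"
  shows "num_spanning_trees G = card {F. F \<subseteq> edges G \<and> min_connects (verts G) F}"
proof -
  let ?mk = "\<lambda>F. \<lparr> verts = verts G, edges = F \<rparr>"
  have "spanning_tree T G \<longleftrightarrow>
      verts T = verts G \<and> edges T \<subseteq> edges G \<and> min_connects (verts G) (edges T)" for T
  proof -
    have "simple_graph T" if "verts T = verts G" "edges T \<subseteq> edges G"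
      using assms that by (auto simp: simple_graph_def)
    then show ?thesis
      unfolding spanning_tree_def using tree_iff_min_connects by metis
  qed
  moreover have "T = ?mk (edges T)" if "verts T = verts G" for T :: "'a ugraph"
    using that by (cases T) simp
  ultimately have "{T. spanning_tree T G} = ?mk ` {F. F \<subseteq> edges G \<and> min_connects (verts G) F}"
    by (intro equalityI subsetI) (auto intro: rev_image_eqI)
  then show ?thesis
    by (simp add: num_spanning_trees_def card_image inj_on_def)
qed

section \<open>Replacing every edge by a 4-cycle\<close>

text \<open>The two new vertices of the gadget on the edge \<open>e\<close> are \<open>w e True\<close> and \<open>w e False\<close>. An edge
  set of the refined graph is encoded by the map \<open>M\<close> that assigns to \<open>e\<close> and \<open>i\<close> the set of
  neighbours of \<open>w e i\<close>.\<close>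

locale edge_replacement =
  fixes V :: "'a set" and E :: "'a set set" and w :: "'a set \<Rightarrow> bool \<Rightarrow> 'a"
  assumes finite_V: "finite V"
    and edge: "e \<in> E \<Longrightarrow> \<exists>x\<in>V. \<exists>y\<in>V. x \<noteq> y \<and> e = {x, y}"
    and w_inj: "e \<in> E \<Longrightarrow> e' \<in> E \<Longrightarrow> w e i = w e' j \<Longrightarrow> e = e' \<and> i = j"
    and w_fresh: "e \<in> E \<Longrightarrow> w e i \<notin> V"
begin

definition V' :: "'a set" where
  "V' = V \<union> {w e i | e i. e \<in> E}"

definition edges_of :: "('a set \<Rightarrow> bool \<Rightarrow> 'a set) \<Rightarrow> 'a set set" where
  "edges_of M = {{x, w e i} | x e i. e \<in> E \<and> x \<in> M e i}"

definition E' :: "'a set set" where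
  "E' = edges_of (\<lambda>e i. e)"

text \<open>The edges whose gadget joins their two ends, which happens only through a new vertex
  adjacent to both.\<close>

definition full :: "('a set \<Rightarrow> bool \<Rightarrow> 'a set) \<Rightarrow> 'a set set" where
  "full M = {e \<in> E. \<exists>i. M e i = e}"

text \<open>The configurations of one gadget that occur in spanning trees, with \<open>b\<close>
  telling whether the gadget joins the ends of \<open>e\<close>.\<close>

definition states :: "bool \<Rightarrow> 'a set \<Rightarrow> (bool \<Rightarrow> 'a set) set" where
  "states b e = {h. (\<forall>i. h i \<subseteq> e \<and> h i \<noteq> {}) \<and> \<not> (\<forall>i. h i = e) \<and> ((\<exists>i. h i = e) \<longleftrightarrow> b)}"

section \<open>Connectivity and minimality in terms of the encoding\<close>

lemma edge_subset: "e \<in> E \<Longrightarrow> e \<subseteq> V"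
  using edge by blast

lemma finite_E: "finite E"
  using finite_V edge_subset by (meson Pow_iff finite_Pow_iff finite_subset subsetI)

text \<open>Freshness tells the new end of an edge from the old one, and injectivity of
  \<open>w\<close> then recovers \<open>e\<close> and \<open>i\<close>; hence the encoding loses
  nothing.\<close>

lemma mem_edges_of_iff:
  assumes "\<And>e i. e \<in> E \<Longrightarrow> M e i \<subseteq> e" "e \<in> E"
  shows "{x, w e i} \<in> edges_of M \<longleftrightarrow> x \<in> M e i"
proof
  assume "{x, w e i} \<in> edges_of M"
  then obtain x' e' i' where *: "{x, w e i} = {x', w e' i'}" "e' \<in> E" "x' \<in> M e' i'"
    by (auto simp: edges_of_def)
  then have "x' \<in> V" using assms(1) edge_subset by blast
  then have "w e i = w e' i'" "x = x'"
    using * w_fresh[OF assms(2), of i] by (auto simp: doubleton_eq_iff)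
  then show "x \<in> M e i" using * w_inj assms(2) by blast
qed (use assms(2) in \<open>auto simp: edges_of_def\<close>)

text \<open>Contracting each new vertex to one of its neighbours turns connections in the refined
  graph into connections along \<open>full M\<close>. Conversely, an edge of \<open>full M\<close>
  is replaced by a path of length two, and every new vertex hangs on an old one.\<close>

lemma connects_edges_of_iff:
  assumes M: "\<And>e i. e \<in> E \<Longrightarrow> M e i \<subseteq> e"
  shows "connects V' (edges_of M) \<longleftrightarrow> (\<forall>e\<in>E. \<forall>i. M e i \<noteq> {}) \<and> connects V (full M)"
proof (intro iffI conjI ballI allI)
  assume c: "connects V' (edges_of M)"
  show ne: "M e i \<noteq> {}" if e: "e \<in> E" for e i
  proof -
    obtain x where x: "x \<in> e" "x \<in> V" using edge[OF e] by auto
    then have "linked (edges_of M) (w e i) x"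
      using c e by (auto simp: connects_def V'_def)
    moreover have "w e i \<noteq> x" using x w_fresh[OF e] by auto
    ultimately obtain z where "{w e i, z} \<in> edges_of M"
      unfolding linked_def by (auto elim: converse_rtranclpE)
    then have "z \<in> M e i" using mem_edges_of_iff[of M, OF M e] by (simp add: insert_commute)
    then show ?thesis by auto
  qed
  \<comment> \<open>\<open>p\<close> fixes the old vertices and sends each new vertex to a chosen
    neighbour.\<close>
  define p where "p z = (if z \<in> V then z else
    (SOME x. \<exists>e i. e \<in> E \<and> z = w e i \<and> x \<in> M e i))" for z
  have p_w: "p (w e i) \<in> M e i" if e: "e \<in> E" for e i
  proof -
    have "\<exists>x e' i'. e' \<in> E \<and> w e i = w e' i' \<and> x \<in> M e' i'" using ne[OF e] e by blast
    from someI_ex[OF this] obtain e' i' where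
      "e' \<in> E" "w e i = w e' i'" "p (w e i) \<in> M e' i'"
      using w_fresh[OF e, of i] by (auto simp: p_def)
    then show ?thesis using w_inj e by blast
  qed
  \<comment> \<open>If \<open>x\<close> is not the chosen neighbour, then \<open>M e i\<close>
    contains two distinct elements of the two-element set \<open>e\<close>, so \<open>e\<close>
    itself belongs to \<open>full M\<close>.\<close>
  have p_edge: "linked (full M) x (p (w e i))" if e: "e \<in> E" "x \<in> M e i" for e x i
  proof (cases "x = p (w e i)")
    case False
    obtain q where q: "q = p (w e i)" by simp
    obtain a b where "e = {a, b}" using edge[OF e(1)] by auto
    moreover have "x \<in> e" "q \<in> e" using e p_w[OF e(1), of i] M[OF e(1), of i] q by auto
    ultimately have "e = {x, q}" using False q by auto
    moreover have "{x, q} \<subseteq> M e i" using e p_w[OF e(1), of i] q by simp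
    ultimately show ?thesis using e(1) M[OF e(1), of i] q by (intro linked_edge) (auto simp: full_def)
  qed simp
  have step: "linked (full M) (p x) (p y)" if xy: "{x, y} \<in> edges_of M" for x y
  proof -
    obtain z e i where *: "{x, y} = {z, w e i}" "e \<in> E" "z \<in> M e i"
      using xy by (auto simp: edges_of_def)
    then have "z \<in> V" using M edge_subset by blast
    then have "linked (full M) (p z) (p (w e i))" using p_edge * by (simp add: p_def)
    then show ?thesis using * linked_sym by (auto simp: doubleton_eq_iff)
  qed
  show "connects V (full M)"
    unfolding connects_def
  proof (intro conjI ballI)
    have "V' \<noteq> {}" using c by (simp add: connects_def)
    then show "V \<noteq> {}" unfolding V'_def using edge by blast
    fix x y assume xy: "x \<in> V" "y \<in> V"
    then have "linked (edges_of M) x y" using c by (auto simp: connects_def V'_def)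
    from linked_lift[where p = p, OF this step] show "linked (full M) x y"
      using xy by (simp add: p_def)
  qed
next
  assume R: "(\<forall>e\<in>E. \<forall>i. M e i \<noteq> {}) \<and> connects V (full M)"
  have step: "linked (edges_of M) x y" if xy: "{x, y} \<in> full M" for x y
  proof -
    obtain i where i: "{x, y} \<in> E" "M {x, y} i = {x, y}" using xy by (auto simp: full_def)
    then have "linked (edges_of M) x (w {x, y} i)" "linked (edges_of M) y (w {x, y} i)"
      by (auto intro!: linked_edge simp: mem_edges_of_iff[of M, OF M])
    then show ?thesis by (blast intro: linked_sym linked_trans)
  qed
  have "linked (edges_of M) x y" if "linked (full M) x y" for x y
    by (rule linked_lift[where p = "\<lambda>x. x", OF that step])
  then have old: "linked (edges_of M) x y" if "x \<in> V" "y \<in> V" for x y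
    using that R by (auto simp: connects_def)
  have "\<exists>x\<in>V. linked (edges_of M) z x" if "z \<in> V'" for z
  proof (cases "z \<in> V")
    case False
    then obtain e i where e: "e \<in> E" "z = w e i" using \<open>z \<in> V'\<close> by (auto simp: V'_def)
    then obtain x where "x \<in> M e i" using R by blast
    then have "{x, z} \<in> edges_of M" "x \<in> V"
      using e M[OF e(1), of i] edge_subset[OF e(1)] mem_edges_of_iff[of M, OF M] by auto
    then show ?thesis using linked_edge linked_sym by metis
  next
    case True
    then show ?thesis by (intro bexI[of _ z]) simp_all
  qed
  then have "linked (edges_of M) y z" if "y \<in> V'" "z \<in> V'" for y z
    using that old by (meson linked_sym linked_trans)
  then show "connects V' (edges_of M)"
    using R by (auto simp: connects_def V'_def)
qed

text \<open>Deleting an edge stays within the encoding, so the connectivity criterion applies again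
  after the deletion.\<close>

lemma edges_of_remove:
  assumes M: "\<And>e i. e \<in> E \<Longrightarrow> M e i \<subseteq> e" and e: "e \<in> E"
  shows "edges_of M - {{x, w e i}} = edges_of (M(e := (M e)(i := M e i - {x})))"
    (is "_ = edges_of ?M")
proof -
  have M': "?M e' j \<subseteq> e'" if "e' \<in> E" for e' j
    using M[OF that, of j] by (auto simp: fun_upd_def)
  have sub: "edges_of ?M \<subseteq> edges_of M"
    unfolding edges_of_def by (auto split: if_splits)
  have "{x, w e i} \<in> edges_of ?M \<longleftrightarrow> x \<in> ?M e i"
    by (rule mem_edges_of_iff[OF M' e])
  then have "{x, w e i} \<notin> edges_of ?M" by simp
  moreover have "d \<in> edges_of ?M" if d: "d \<in> edges_of M" "d \<noteq> {x, w e i}" for d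
  proof -
    obtain z e' j where *: "d = {z, w e' j}" "e' \<in> E" "z \<in> M e' j"
      using d(1) by (auto simp: edges_of_def)
    then show ?thesis
      using d(2) unfolding edges_of_def by (auto simp: fun_upd_def intro!: exI[of _ z] exI[of _ e'] exI[of _ j])
  qed
  ultimately show ?thesis using sub by blast
qed

text \<open>Deleting the only edge at a new vertex isolates it. Deleting one of two edges at a new
  vertex removes \<open>e\<close> from \<open>full M\<close>, unless the other new vertex also joins
  the ends; in that case the deleted edge was redundant.\<close>

lemma min_connects_edges_of_iff:
  assumes M: "\<And>e i. e \<in> E \<Longrightarrow> M e i \<subseteq> e"
  shows "min_connects V' (edges_of M) \<longleftrightarrow>
    (\<forall>e\<in>E. (\<forall>i. M e i \<noteq> {}) \<and> \<not> (\<forall>i. M e i = e)) \<and> min_connects V (full M)"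
proof -
  \<comment> \<open>\<open>R e i x\<close> encodes the edge set after \<open>x\<close> has been
    detached from \<open>w e i\<close>.\<close>
  define R where "R e i x = M(e := (M e)(i := M e i - {x}))" for e i x
  have R_sub: "R e i x e' j \<subseteq> e'" if "e' \<in> E" for e i x e' j
    using M[OF that, of j] by (auto simp: R_def)
  have remove: "edges_of M - {{x, w e i}} = edges_of (R e i x)" if "e \<in> E" for e i x
    unfolding R_def by (rule edges_of_remove[OF M that])
  have full_R: "full (R e i x) = full M - {e}"
    if "e \<in> E" "x \<in> e" "\<not> (\<forall>i. M e i = e)" "M e i = e" for e i x
  proof -
    have "M e (\<not> i) \<noteq> e" using that(3,4) by (cases i) (auto simp: all_bool_eq)
    then have "R e i x e j \<noteq> e" for j
      using that(2,4) by (cases "j = i") (auto simp: R_def)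
    then show ?thesis by (auto simp: full_def R_def)
  qed
  have R_ne: "R e i x e' j \<noteq> {}"
    if "e \<in> E" "M e i = e" "e' \<in> E" "\<And>e i. e \<in> E \<Longrightarrow> M e i \<noteq> {}" for e i x e' j
    using edge[OF that(1)] that by (auto simp: R_def)
  show ?thesis
  proof (intro iffI)
    assume L: "min_connects V' (edges_of M)"
    then have c: "connects V' (edges_of M)" by (simp add: min_connects_def)
    then have ne: "\<And>e i. e \<in> E \<Longrightarrow> M e i \<noteq> {}" and cf: "connects V (full M)"
      using connects_edges_of_iff[of M, OF M] by auto
    have no: "\<not> connects V (full (R e i x))" if "e \<in> E" "x \<in> e" "M e i = e" for e i x
    proof
      assume "connects V (full (R e i x))"
      then have "connects V' (edges_of M - {{x, w e i}})"
        unfolding remove[OF that(1)]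
        using connects_edges_of_iff[of "R e i x", OF R_sub] R_ne[OF that(1,3) _ ne] by blast
      moreover have "{x, w e i} \<in> edges_of M" using that mem_edges_of_iff[of M, OF M] by auto
      ultimately show False using L by (auto simp: min_connects_def)
    qed
    \<comment> \<open>If both new vertices joined the ends, detaching \<open>x\<close> from one
      would leave \<open>full M\<close> unchanged because of the other, contradicting
      \<open>no\<close>.\<close>
    have nb: "\<not> (\<forall>i. M e i = e)" if e: "e \<in> E" for e
    proof
      assume a: "\<forall>i. M e i = e"
      obtain x where x: "x \<in> e" using edge[OF e] by auto
      have "R e True x e False = e" using a by (simp add: R_def)
      then have "full (R e True x) = full M"
        using a by (auto simp: full_def R_def)
      then show False using no[OF e x, of True] a cf by simp
    qed
    have "\<not> connects V (full M - {e})" if e: "e \<in> full M" for e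
    proof -
      obtain i where i: "e \<in> E" "M e i = e" using e by (auto simp: full_def)
      obtain x where x: "x \<in> e" using edge[OF i(1)] by auto
      show ?thesis using no[OF i(1) x i(2)] full_R[OF i(1) x nb[OF i(1)] i(2)] by simp
    qed
    with ne nb cf show "(\<forall>e\<in>E. (\<forall>i. M e i \<noteq> {}) \<and> \<not> (\<forall>i. M e i = e)) \<and> min_connects V (full M)"
      by (auto simp: min_connects_def)
  next
    assume A: "(\<forall>e\<in>E. (\<forall>i. M e i \<noteq> {}) \<and> \<not> (\<forall>i. M e i = e)) \<and> min_connects V (full M)"
    then have c: "connects V' (edges_of M)"
      using connects_edges_of_iff[of M, OF M] by (auto simp: min_connects_def)
    have "\<not> connects V' (edges_of M - {d})" if d: "d \<in> edges_of M" for d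
    proof
      assume cd: "connects V' (edges_of M - {d})"
      obtain x e i where *: "d = {x, w e i}" "e \<in> E" "x \<in> M e i"
        using d by (auto simp: edges_of_def)
      have cR: "R e i x e i \<noteq> {}" "connects V (full (R e i x))"
        using cd connects_edges_of_iff[of "R e i x", OF R_sub] *(2)
        unfolding *(1) remove[OF *(2)] by auto
      \<comment> \<open>Connectivity after the deletion leaves \<open>w e i\<close> a second
        neighbour, so it was attached to both ends and the deletion takes \<open>e\<close> out of
        \<open>full M\<close>, against minimality.\<close>
      then obtain y where y: "y \<in> M e i" "y \<noteq> x" by (auto simp: R_def)
      have "x \<in> e" "y \<in> e" using y *(3) M[OF *(2), of i] by blast+
      then have "z = x \<or> z = y" if "z \<in> e" for z
        using edge[OF *(2)] y(2) that by auto
      then have f: "M e i = e" "x \<in> e" using \<open>x \<in> e\<close> y *(3) M[OF *(2), of i] by blast+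
      moreover have "\<not> (\<forall>i. M e i = e)" using A *(2) by blast
      ultimately have "full (R e i x) = full M - {e}" using full_R[OF *(2)] by simp
      moreover have "e \<in> full M" unfolding full_def using f(1) *(2) by blast
      ultimately show False using cR(2) A unfolding min_connects_def by metis
    qed
    with c show "min_connects V' (edges_of M)" unfolding min_connects_def by blast
  qed
qed

section \<open>Counting gadget states, spanning trees and edges\<close>

lemma card_states:
  assumes "e \<in> E"
  shows "card (states b e) = 4"
proof -
  obtain x y where e: "x \<noteq> y" "e = {x, y}" using edge[OF assms] by auto
  \<comment> \<open>\<open>P\<close> lists the pairs \<open>(h True, h False)\<close>. A joined
    gadget has a choice of the vertex attached to both ends and of the end for the other; an
    unjoined one has a choice of end for each vertex.\<close>
  define P where "P = (if b then {({x}, e), ({y}, e), (e, {x}), (e, {y})}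
    else {({x}, {x}), ({x}, {y}), ({y}, {x}), ({y}, {y})})"
  let ?f = "\<lambda>(A, B) i. if i then A else B"
  have "states b e = {h. (h True, h False) \<in> P}"
  proof -
    have "{A. A \<subseteq> e \<and> A \<noteq> {}} = {{x}, {y}, e}" using e by auto
    then have "A \<subseteq> e \<and> A \<noteq> {} \<longleftrightarrow> A = {x} \<or> A = {y} \<or> A = e" for A by blast
    moreover have "{x} \<noteq> e" "{y} \<noteq> e" using e by auto
    ultimately show ?thesis
      unfolding states_def P_def
      by (cases b; simp add: all_bool_eq ex_bool_eq; intro Collect_cong; auto)
  qed
  also have "\<dots> = ?f ` P"
  proof -
    have "h = ?f (h True, h False)" for h :: "bool \<Rightarrow> 'a set" by (auto simp: fun_eq_iff)
    then show ?thesis by (intro equalityI subsetI) (auto intro: rev_image_eqI)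
  qed
  also have "card (?f ` P) = card P"
    by (rule card_image) (auto simp: inj_on_def fun_eq_iff all_bool_eq)
  also have "card P = 4"
    using e by (auto simp: P_def doubleton_eq_iff)
  finally show ?thesis .
qed

text \<open>The index \<open>S\<close> is \<open>full M\<close>. Once it is fixed, the remaining
  conditions concern each gadget separately, which gives a dependent product.\<close>

lemma min_connects_V'_eq:
  "{F. F \<subseteq> E' \<and> min_connects V' F} =
    edges_of ` (\<Union>S\<in>{S. S \<subseteq> E \<and> min_connects V S}. PiE E (\<lambda>e. states (e \<in> S) e))"
    (is "?L = edges_of ` ?R")
proof (intro equalityI subsetI)
  fix F assume F: "F \<in> ?L"
  \<comment> \<open>Restriction to \<open>E\<close> makes \<open>M\<close> extensional, as
    membership in \<open>PiE\<close> requires.\<close>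
  define M where "M = (\<lambda>e\<in>E. \<lambda>i. {x \<in> e. {x, w e i} \<in> F})"
  have M: "M e i \<subseteq> e" if "e \<in> E" for e i using that by (auto simp: M_def)
  have "F = edges_of M"
  proof -
    have "d \<in> edges_of M" if "d \<in> F" for d
      using that F by (fastforce simp: E'_def edges_of_def M_def)
    moreover have "d \<in> F" if "d \<in> edges_of M" for d
      using that by (auto simp: edges_of_def M_def)
    ultimately show ?thesis by blast
  qed
  moreover have "M \<in> ?R"
  proof -
    have "(\<forall>e\<in>E. (\<forall>i. M e i \<noteq> {}) \<and> \<not> (\<forall>i. M e i = e)) \<and> min_connects V (full M)"
      using F min_connects_edges_of_iff[of M, OF M] \<open>F = edges_of M\<close> by simp
    moreover have "full M \<subseteq> E" by (auto simp: full_def)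
    moreover have "M \<in> extensional E" by (simp add: M_def)
    moreover have "M e \<in> states (e \<in> full M) e" if "e \<in> E" for e
      using M[OF that] calculation(1) that by (auto simp: states_def full_def)
    ultimately have "full M \<in> {S. S \<subseteq> E \<and> min_connects V S}"
      "M \<in> PiE E (\<lambda>e. states (e \<in> full M) e)" by (auto intro!: PiE_I dest: extensional_arb)
    then show ?thesis by blast
  qed
  ultimately show "F \<in> edges_of ` ?R" by blast
next
  fix F assume "F \<in> edges_of ` ?R"
  then obtain S M where F: "F = edges_of M" and S: "S \<subseteq> E" "min_connects V S"
    and PiE: "M \<in> PiE E (\<lambda>e. states (e \<in> S) e)" by blast
  have st: "M e \<in> states (e \<in> S) e" if "e \<in> E" for e
    using PiE_mem[OF PiE that] .
  have M: "M e i \<subseteq> e" if "e \<in> E" for e i using st[OF that] by (auto simp: states_def)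
  have "full M = S" using S(1) st by (fastforce simp: full_def states_def)
  moreover have "\<forall>e\<in>E. (\<forall>i. M e i \<noteq> {}) \<and> \<not> (\<forall>i. M e i = e)"
    using st by (auto simp: states_def)
  ultimately have "min_connects V' F" using min_connects_edges_of_iff[of M, OF M] S F by simp
  moreover have "F \<subseteq> E'" using M unfolding F E'_def edges_of_def by blast
  ultimately show "F \<in> ?L" by simp
qed

text \<open>The encoding is injective on extensional maps and the products for different
  \<open>S\<close> are disjoint. Each has \<open>4 ^ card E\<close> elements, because joined and
  unjoined gadgets have equally many states.\<close>

lemma card_min_connects_V':
  "card {F. F \<subseteq> E' \<and> min_connects V' F} = card {S. S \<subseteq> E \<and> min_connects V S} * 4 ^ card E"
proof -
  let ?T = "{S. S \<subseteq> E \<and> min_connects V S}"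
  let ?P = "\<lambda>S. PiE E (\<lambda>e. states (e \<in> S) e)"
  have inj: "inj_on edges_of (\<Union>S\<in>?T. ?P S)"
  proof (rule inj_onI)
    fix M N assume MN: "M \<in> (\<Union>S\<in>?T. ?P S)" "N \<in> (\<Union>S\<in>?T. ?P S)"
      and eq: "edges_of M = edges_of N"
    obtain S S' where PiE: "M \<in> ?P S" "N \<in> ?P S'" using MN by blast
    have sub: "M e i \<subseteq> e" "N e i \<subseteq> e" if "e \<in> E" for e i
      using PiE_mem[OF PiE(1) that] PiE_mem[OF PiE(2) that] by (auto simp: states_def)
    have "x \<in> M e i \<longleftrightarrow> x \<in> N e i" if "e \<in> E" for e i x
      using mem_edges_of_iff[of M e x i, OF sub(1) that] mem_edges_of_iff[of N e x i, OF sub(2) that]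
        eq by simp
    then have "M e = N e" if "e \<in> E" for e using that by (intro ext) blast
    then show "M = N" using PiE by (metis PiE_arb ext)
  qed
  have fin: "finite ?T" using finite_E by simp
  have "finite (states b e)" if "e \<in> E" for b e
    using card_states[OF that, of b] by (metis card.infinite zero_neq_numeral)
  then have finP: "finite (?P S)" for S using finite_E by (auto intro: finite_PiE)
  \<comment> \<open>At an edge lying in only one of \<open>S\<close> and \<open>S'\<close>, the
    gadget would have to be both joined and unjoined.\<close>
  have disj: "?P S \<inter> ?P S' = {}" if "S \<in> ?T" "S' \<in> ?T" "S \<noteq> S'" for S S'
  proof -
    obtain e where "e \<in> E" "(e \<in> S) \<noteq> (e \<in> S')" using \<open>S \<noteq> S'\<close> \<open>S \<in> ?T\<close> \<open>S' \<in> ?T\<close> by auto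
    moreover have "states (e \<in> S) e \<inter> states (e \<in> S') e = {}"
      using calculation(2) by (auto simp: states_def)
    ultimately show ?thesis by (blast dest: PiE_mem)
  qed
  have "card {F. F \<subseteq> E' \<and> min_connects V' F} = card (\<Union>S\<in>?T. ?P S)"
    unfolding min_connects_V'_eq using inj by (rule card_image)
  also have "\<dots> = (\<Sum>S\<in>?T. card (?P S))"
    using fin finP disj by (intro card_UN_disjoint) auto
  also have "\<dots> = (\<Sum>S\<in>?T. 4 ^ card E)"
    using finite_E card_states by (simp add: card_PiE)
  finally show ?thesis by simp
qed

text \<open>Each new edge comes from exactly one triple of an old edge, one of its two ends and one
  of two new vertices.\<close>

lemma card_E': "card E' = 4 * card E"
proof -
  let ?X = "SIGMA e:E. e \<times> (UNIV :: bool set)"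
  have "E' = (\<lambda>(e, x, i). {x, w e i}) ` ?X"
    unfolding E'_def edges_of_def
  proof (intro equalityI subsetI)
    fix d assume "d \<in> {{x, w e i} | x e i. e \<in> E \<and> x \<in> e}"
    then obtain x e i where "d = {x, w e i}" "e \<in> E" "x \<in> e" by blast
    then show "d \<in> (\<lambda>(e, x, i). {x, w e i}) ` ?X" by (intro image_eqI[of _ _ "(e, x, i)"]) auto
  qed auto
  moreover have "inj_on (\<lambda>(e, x, i). {x, w e i}) ?X"
  proof (rule inj_onI)
    fix p q assume "p \<in> ?X" "q \<in> ?X"
      and eq: "(\<lambda>(e, x, i). {x, w e i}) p = (\<lambda>(e, x, i). {x, w e i}) q"
    then obtain e x i e' x' i' where pq: "p = (e, x, i)" "q = (e', x', i')"
      and *: "e \<in> E" "x \<in> e" "e' \<in> E" "x' \<in> e'" by blast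
    then have "x \<in> V" "x' \<in> V" using edge_subset by blast+
    then have "x = x' \<and> w e i = w e' i'"
      using eq pq w_fresh[OF *(1), of i] w_fresh[OF *(3), of i'] by (auto simp: doubleton_eq_iff)
    then show "p = q" using w_inj[OF *(1,3)] pq by blast
  qed
  ultimately have "card E' = card ?X" by (simp add: card_image)
  also have "\<dots> = (\<Sum>e\<in>E. 4)"
  proof -
    have c: "finite e \<and> card e = 2" if "e \<in> E" for e using edge[OF that] by auto
    then have "card ?X = (\<Sum>e\<in>E. card (e \<times> (UNIV :: bool set)))"
      using finite_E by (intro card_SigmaI) auto
    then show ?thesis using c by (simp add: card_cartesian_product)
  qed
  finally show ?thesis by simp
qed

end

section \<open>Diamond graphs\<close>

text \<open>\<open>Abs_fset\<close> translates edges as sets into the finite sets under the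
  constructors; it is injective on finite sets, which all edges are.\<close>

definition new_vertex :: "dvertex set \<Rightarrow> bool \<Rightarrow> dvertex" where
  "new_vertex e i = (if i then New_u else New_v) (Abs_fset e)"

lemma new_vertex_pair:
  "new_vertex {x, y} True = New_u {|x, y|}" "new_vertex {x, y} False = New_v {|x, y|}"
proof -
  have "Abs_fset {x, y} = {|x, y|}" using fset_inverse[of "{|x, y|}"] by simp
  then show "new_vertex {x, y} True = New_u {|x, y|}" "new_vertex {x, y} False = New_v {|x, y|}"
    by (simp_all add: new_vertex_def)
qed

lemma edge_replacement_diamond:
  assumes "n \<ge> 1"
  shows "edge_replacement (verts (diamond_graph n)) (edges (diamond_graph n)) new_vertex"
proof
  let ?G = "diamond_graph n"
  show "finite (verts ?G)" using simple_diamond_graph[OF assms] by (simp add: simple_graph_def)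
  show edge: "\<exists>x\<in>verts ?G. \<exists>y\<in>verts ?G. x \<noteq> y \<and> e = {x, y}" if "e \<in> edges ?G" for e
    using simple_diamond_graph[OF assms] that by (simp add: simple_graph_def)
  show "e = e' \<and> i = j"
    if "e \<in> edges ?G" "e' \<in> edges ?G" "new_vertex e i = new_vertex e' j" for e e' i j
  proof -
    have "finite e" "finite e'" using edge[OF that(1)] edge[OF that(2)] by auto
    then show ?thesis using that(3)
      by (auto simp: new_vertex_def Abs_fset_inject split: if_splits)
  qed
  show "new_vertex e i \<notin> verts ?G" if e: "e \<in> edges ?G" for e i
  proof -
    obtain x y where "e = {x, y}" using edge[OF e] by auto
    then show ?thesis
      using diamond_fresh[OF assms, of x y] e by (cases i) (auto simp: new_vertex_pair)
  qed
qed

lemma diamond_refine_eq: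
  assumes "edge_replacement (verts G) (edges G) new_vertex"
  shows "verts (diamond_refine G) = edge_replacement.V' (verts G) (edges G) new_vertex"
    and "edges (diamond_refine G) = edge_replacement.E' (edges G) new_vertex"
proof -
  interpret edge_replacement "verts G" "edges G" new_vertex by fact
  have pair: "\<exists>x y. e = {x, y}" if "e \<in> edges G" for e using edge[OF that] by blast
  \<comment> \<open>The comprehension ranges over ordered pairs and meets each edge in both
    orientations, but \<open>f\<close> depends only on the unordered pair.\<close>
  have image: "{f {x, y} | x y. {x, y} \<in> edges G} = f ` edges G" for f :: "dvertex set \<Rightarrow> 'b"
  proof (intro equalityI subsetI)
    fix c assume "c \<in> f ` edges G"
    then obtain e where e: "c = f e" "e \<in> edges G" by blast
    moreover obtain x y where "e = {x, y}" using pair[OF e(2)] by blast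
    ultimately show "c \<in> {f {x, y} | x y. {x, y} \<in> edges G}" by blast
  qed blast
  have "{new_vertex e i | e i. e \<in> edges G} =
      (\<lambda>e. new_vertex e True) ` edges G \<union> (\<lambda>e. new_vertex e False) ` edges G"
    by (auto simp: ex_bool_eq)
  then show "verts (diamond_refine G) = V'"
    unfolding diamond_refine_sel V'_def new_vertex_pair[symmetric]
      image[of "\<lambda>e. new_vertex e True"] image[of "\<lambda>e. new_vertex e False"]
    by (simp add: Un_assoc)
  \<comment> \<open>The 4-cycle is the complete bipartite graph between the two old ends and the two
    new vertices.\<close>
  have cyc: "cycle4_edges x (New_u {|x, y|}) y (New_v {|x, y|}) =
      {{z, new_vertex {x, y} i} | z i. z \<in> {x, y}}" for x y
  proof -
    have "{{z, f i} | z i. z \<in> {x, y}} = {{x, f True}, {y, f True}, {y, f False}, {x, f False}}"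
      for f :: "bool \<Rightarrow> dvertex"
      by (auto simp: ex_bool_eq)
    then show ?thesis by (simp add: cycle4_edges_def new_vertex_pair insert_commute)
  qed
  have "edges (diamond_refine G) = (\<Union>e\<in>edges G. {{z, new_vertex e i} | z i. z \<in> e})"
    unfolding diamond_refine_sel cyc image[of "\<lambda>e. {{z, new_vertex e i} | z i. z \<in> e}"] ..
  also have "\<dots> = E'" by (auto simp: E'_def edges_of_def)
  finally show "edges (diamond_refine G) = E'" .
qed

lemma diamond_graph_1:
  "card (edges (diamond_graph (Suc 0))) = 4 \<and> num_spanning_trees (diamond_graph (Suc 0)) = 4"
proof -
  \<comment> \<open>With \<open>{VA, VB}\<close> as the only edge, \<open>?w\<close> may ignore its
    edge argument and still be injective.\<close>
  let ?G = "diamond_graph (Suc 0)" and ?V = "{VA, VB}" and ?w = "\<lambda>e i. if i then VU else VV"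
  interpret edge_replacement ?V "{?V}" ?w
    by unfold_locales (auto split: if_splits)
  have V: "verts ?G = V'" by (auto simp: V'_def)
  have E: "edges ?G = E'"
    by (auto simp: E'_def edges_of_def cycle4_edges_def doubleton_eq_iff ex_bool_eq)
  have c1: "connects ?V {?V}"
    using linked_edge[of VA VB "{?V}"] linked_edge[of VB VA "{?V}"]
    by (auto simp: connects_def insert_commute)
  have "\<not> linked {} VA VB"
    unfolding linked_def by (auto elim: converse_rtranclpE)
  then have c0: "\<not> connects ?V {}" by (auto simp: connects_def)
  have "{S. S \<subseteq> {?V} \<and> min_connects ?V S} = {{?V}}"
    using c0 c1 by (auto simp: min_connects_def subset_singleton_iff)
  then have "card {F. F \<subseteq> E' \<and> min_connects V' F} = 4"
    using card_min_connects_V' by simp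
  then show ?thesis
    using num_spanning_trees_eq[OF simple_diamond_graph[of "Suc 0"]] card_E'
    unfolding V E by simp
qed

text \<open>Cubing clears the factor 1/3 in the exponent, so the induction stays within natural
  numbers.\<close>

lemma diamond_graph_counts:
  "card (edges (diamond_graph (Suc n))) = 4 ^ Suc n \<and>
   num_spanning_trees (diamond_graph (Suc n)) ^ 3 = 4 ^ (4 ^ Suc n - 1)"
proof (induction n)
  case 0
  show ?case using diamond_graph_1 by simp
next
  case (Suc n)
  let ?G = "diamond_graph (Suc n)"
  interpret edge_replacement "verts ?G" "edges ?G" new_vertex
    by (rule edge_replacement_diamond) simp
  note eq = diamond_refine_eq[OF edge_replacement_axioms]
  have "card (edges (diamond_graph (Suc (Suc n)))) = 4 ^ Suc (Suc n)"
    using Suc card_E' eq by simp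
  moreover have "num_spanning_trees (diamond_graph (Suc (Suc n))) = num_spanning_trees ?G * 4 ^ 4 ^ Suc n"
    using num_spanning_trees_eq[OF simple_diamond_graph[of "Suc (Suc n)"]]
      num_spanning_trees_eq[OF simple_diamond_graph[of "Suc n"]] card_min_connects_V' Suc eq
    by simp
  \<comment> \<open>The cubed factor \<open>4 ^ 4 ^ Suc n\<close> adds three times
    \<open>4 ^ Suc n\<close> to the exponent.\<close>
  moreover have "(4::nat) ^ (4 ^ Suc n - 1) * (4 ^ 4 ^ Suc n) ^ 3 = 4 ^ (4 ^ Suc (Suc n) - 1)"
  proof -
    have "4 ^ Suc n - 1 + 4 ^ Suc n * 3 = 4 ^ Suc (Suc n) - (1::nat)"
      using one_le_power[of "4::nat" "Suc n"] by simp
    then show ?thesis by (metis power_add power_mult)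
  qed
  ultimately show ?case using Suc by (simp only: power_mult_distrib)
qed

theorem theorem5p7:
  fixes n :: nat
  assumes "n \<ge> 1"
  shows "real (num_spanning_trees (diamond_graph n)) = 2 powr (2 / 3 * (4 ^ n - 1))"
proof -
  obtain m where m: "n = Suc m" using assms by (cases n) auto
  let ?t = "num_spanning_trees (diamond_graph n)"
  have "real ?t ^ 3 = 4 ^ (4 ^ n - 1)"
    using diamond_graph_counts[of m] unfolding m
    by (metis of_nat_numeral of_nat_power)
  \<comment> \<open>The exponent passes from a truncated natural difference to a real one; they
    agree because \<open>4 ^ n\<close> is at least 1.\<close>
  also have "\<dots> = 4 powr (4 ^ n - 1)"
    by (subst powr_realpow[symmetric]) (simp_all add: of_nat_diff)
  also have "\<dots> = (2 powr 2) powr (4 ^ n - 1)" by simp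
  also have "\<dots> = (2 powr (2 / 3 * (4 ^ n - 1))) powr 3"
    unfolding powr_powr by (intro arg_cong[where f = "\<lambda>x. 2 powr x"]) simp
  also have "\<dots> = (2 powr (2 / 3 * (4 ^ n - 1))) ^ 3"
    by simp
  finally show ?thesis
    \<comment> \<open>Nonnegative reals with equal cubes are equal.\<close>
    by (rule power_eq_imp_eq_base) simp_all
qed

end
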